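(* Let $\Sigma_{p,i}$ and $\Sigma_{q,i}$ be impedance passive systems whose signals are dimensionally compatible for the feedback coupling $u_2=\tilde y_1$, $\tilde u_1=y_2$. Assume that at least one of the systems $\Sigma_{p,i}$ and $\Sigma_{q,i}$ is properly impedance passive. Define the external Cayley transformed scattering passive systems $\Sigma_p:=\Sigma_{p,i}(R_p)$ and $\Sigma_q:=\Sigma_{q,i}(R_q)$, where $R_p=\begin{bmatrix}R_{p,1}&0\\ 0&R_{p,2}\end{bmatrix}$ and $R_q=\begin{bmatrix}R_{q,1}&0\\ 0&R_{q,2}\end{bmatrix}$, satisfying $R_{p,2}=R_{q,1}$, are invertible, positive resistance matrices. Then the following holds. (1) The internal feedback loop of the connection of $\Sigma_p$ and $\Sigma_q$ is well-posed, and the Redheffer star product $\Sigma_p\star\Sigma_q$ exists. (2) There exists an impedance passive system $\Sigma_i'$ whose external Cayley transform $\Sigma'(R_{p,q})$ satisfies $\Sigma'(R_{p,q})=\Sigma_p\star\Sigma_q$ with $R_{p,q}:=\begin{bmatrix}R_{p,1}&0\\ 0&R_{q,2}\end{bmatrix}$.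
   Context: All matrices and signals are real and finite-dimensional; norms and inner products are Euclidean. A linear system $\Sigma=\begin{bmatrix}A&B\\ C&D\end{bmatrix}$ is the quadruple of matrices in $x'(t)=Ax(t)+Bu(t)$, $y(t)=Cx(t)+Du(t)$, $t\in I$ ($I\subset\mathbb R$ an interval, signals sufficiently smooth). Input and output have the same even dimension $m$ and are split as $u=\begin{bmatrix}u_1\\ u_2\end{bmatrix}$, $y=\begin{bmatrix}y_1\\ y_2\end{bmatrix}$ with all components of dimension $m/2$; $B,C,D$ and resistance matrices are split accordingly. $\Sigma$ is impedance passive if all functions $u,x,y$ satisfying the equations satisfy $\frac{d}{dt}\|x(t)\|^2\le2\langle u(t),y(t)\rangle$, and scattering passive if they satisfy $\frac{d}{dt}\|x(t)\|^2\le\|u(t)\|^2-\|y(t)\|^2$. An impedance passive system with feedthrough matrix $D_i$ is properly impedance passive if the matrix $D_i^T+D_i\ge0$ is invertible. For a symmetric positive, invertible, block diagonal resistance matrix $R$, the external Cayley transform $\Sigma(R)=\begin{bmatrix}A&B\\ C&D\end{bmatrix}$ (also written $\Sigma_i(R)$) of $\Sigma_i=\begin{bmatrix}A_i&B_i\\ C_i&D_i\end{bmatrix}$ is $$A=A_i-B_i(D_i+R)^{-1}C_i,\quad B=\sqrt2B_i(D_i+R)^{-1}R^{1/2},\quad C=\sqrt2R^{1/2}(D_i+R)^{-1}C_i,\quad D=I-2R^{1/2}(D_i+R)^{-1}R^{1/2}$$ (defined when $D_i+R$ is invertible). For $\Sigma_p$ with input $(u_1,u_2)$, output $(y_1,y_2)$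 and matrices $A_p,B_{p_j},C_{p_j},D_{p_{jk}}$, and $\Sigma_q$ with input $(\tilde u_1,\tilde u_2)$, output $(\tilde y_1,\tilde y_2)$ and matrices $A_q,B_{q_j},C_{q_j},D_{q_{jk}}$, consider the feedback connection $u_2=\tilde y_1$, $\tilde u_1=y_2$ with external input $(u_1,\tilde u_2)$ and external output $(y_1,\tilde y_2)$. The feedback loop is well-posed if both $\Delta_1:=I-D_{p_{22}}D_{q_{11}}$ and $\Delta_2:=I-D_{q_{11}}D_{p_{22}}$ are invertible. In that case the Redheffer star product $\Sigma_p\star\Sigma_q=\begin{bmatrix}A&B\\ C&D\end{bmatrix}$ is defined by $$A=\begin{bmatrix}A_p+B_{p_2}\Delta_2^{-1}D_{q_{11}}C_{p_2}&B_{p_2}\Delta_2^{-1}C_{q_1}\\ B_{q_1}\Delta_1^{-1}C_{p_2}&A_q+B_{q_1}\Delta_1^{-1}D_{p_{22}}C_{q_1}\end{bmatrix},$$ $$B=\begin{bmatrix}B_{p_1}+B_{p_2}\Delta_2^{-1}D_{q_{11}}D_{p_{21}}&B_{p_2}\Delta_2^{-1}D_{q_{12}}\\ B_{q_1}\Delta_1^{-1}D_{p_{21}}&B_{q_2}+B_{q_1}\Delta_1^{-1}D_{p_{22}}D_{q_{12}}\end{bmatrix},$$ $$C=\begin{bmatrix}C_{p_1}+D_{p_{12}}\Delta_2^{-1}D_{q_{11}}C_{p_2}&D_{p_{12}}\Delta_2^{-1}C_{q_1}\\ D_{q_{21}}\Delta_1^{-1}C_{p_2}&C_{q_2}+D_{q_{21}}\Delta_1^{-1}D_{p_{22}}C_{q_1}\end{bmatrix},$$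 $$D=\begin{bmatrix}D_{p_{11}}+D_{p_{12}}\Delta_2^{-1}D_{q_{11}}D_{p_{21}}&D_{p_{12}}\Delta_2^{-1}D_{q_{12}}\\ D_{q_{21}}\Delta_1^{-1}D_{p_{21}}&D_{q_{22}}+D_{q_{21}}\Delta_1^{-1}D_{p_{22}}D_{q_{12}}\end{bmatrix}.$$ *)

theory Defs
  imports "HOL-Analysis.Analysis"
begin

definition block_mat ::
  "real^'c^'a \<Rightarrow> real^'d^'a \<Rightarrow> real^'c^'b \<Rightarrow> real^'d^'b \<Rightarrow>
   real^('c::finite + 'd::finite)^('a::finite + 'b::finite)" where
  "block_mat M11 M12 M21 M22 = (\<chi> i j.
     case i of
       Inl a \<Rightarrow> (case j of Inl c \<Rightarrow> M11 $ a $ c | Inr d \<Rightarrow> M12 $ a $ d)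
     | Inr b \<Rightarrow> (case j of Inl c \<Rightarrow> M21 $ b $ c | Inr d \<Rightarrow> M22 $ b $ d))"

abbreviation block_diag ::
  "real^'a^'a \<Rightarrow> real^'b^'b \<Rightarrow> real^('a::finite + 'b::finite)^('a + 'b)" where
  "block_diag M N \<equiv> block_mat M 0 0 N"

definition col1 :: "real^('c::finite + 'd::finite)^'a::finite \<Rightarrow> real^'c^'a" where
  "col1 M = (\<chi> i j. M $ i $ Inl j)"

definition col2 :: "real^('c::finite + 'd::finite)^'a::finite \<Rightarrow> real^'d^'a" where
  "col2 M = (\<chi> i j. M $ i $ Inr j)"

definition row1 :: "real^'c::finite^('a::finite + 'b::finite) \<Rightarrow> real^'c^'a" where
  "row1 M = (\<chi> i j. M $ Inl i $ j)"

definition row2 :: "real^'c::finite^('a::finite + 'b::finite) \<Rightarrow> real^'c^'b" where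
  "row2 M = (\<chi> i j. M $ Inr i $ j)"


definition positive_mat :: "real^'n^'n::finite \<Rightarrow> bool" where
  "positive_mat R \<longleftrightarrow> transpose R = R \<and> (\<forall>x. 0 \<le> x \<bullet> (R *v x))"

definition mat_sqrt :: "real^'n^'n::finite \<Rightarrow> real^'n^'n" where
  "mat_sqrt R = (THE S. positive_mat S \<and> S ** S = R)"


text \<open>
  \<open>'n\<close> indexes the state space, \<open>'m\<close> both the input and the output space.
  Where the splitting of signals into two halves matters, \<open>'m\<close> is \<open>'k + 'k\<close>.
\<close>

datatype ('n::finite, 'm::finite) linsys =
  LinSys (matA: "real^'n^'n") (matB: "real^'m^'n") (matC: "real^'n^'m") (matD: "real^'m^'m")

text \<open>
  Classical trajectories on \<open>I\<close>: the input is continuous, hence the state is continuously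
  differentiable and the output is continuous.
  Derivatives at end points belonging to \<open>I\<close> are one-sided.
\<close>

definition trajectory ::
  "('n::finite, 'm::finite) linsys \<Rightarrow> real set \<Rightarrow>
   (real \<Rightarrow> real^'m) \<Rightarrow> (real \<Rightarrow> real^'n) \<Rightarrow> (real \<Rightarrow> real^'m) \<Rightarrow> bool" where
  "trajectory S I u x y \<longleftrightarrow>
     continuous_on I u \<and>
     (\<forall>t\<in>I. (x has_vector_derivative (matA S *v x t + matB S *v u t)) (at t within I)) \<and>
     (\<forall>t\<in>I. y t = matC S *v x t + matD S *v u t)"

text \<open>
  Intervals are required to have nonempty interior because a derivative
  relative to a single point carries no information.
\<close>

definition impedance_passive :: "('n::finite, 'm::finite) linsys \<Rightarrow> bool" where
  "impedance_passive S \<longleftrightarrow>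
     (\<forall>I u x y. is_interval I \<and> interior I \<noteq> {} \<and> trajectory S I u x y \<longrightarrow>
        (\<forall>t\<in>I. \<exists>d. ((\<lambda>s. (norm (x s))\<^sup>2) has_real_derivative d) (at t within I) \<and>
                  d \<le> 2 * (u t \<bullet> y t)))"

definition scattering_passive :: "('n::finite, 'm::finite) linsys \<Rightarrow> bool" where
  "scattering_passive S \<longleftrightarrow>
     (\<forall>I u x y. is_interval I \<and> interior I \<noteq> {} \<and> trajectory S I u x y \<longrightarrow>
        (\<forall>t\<in>I. \<exists>d. ((\<lambda>s. (norm (x s))\<^sup>2) has_real_derivative d) (at t within I) \<and>
                  d \<le> (norm (u t))\<^sup>2 - (norm (y t))\<^sup>2))"

definition properly_impedance_passive :: "('n::finite, 'm::finite) linsys \<Rightarrow> bool" where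
  "properly_impedance_passive S \<longleftrightarrow>
     impedance_passive S \<and> invertible (transpose (matD S) + matD S)"


text \<open>
  The transform is defined if \<open>cayley_defined S R\<close> holds; otherwise the value of
  \<open>cayley S R\<close> has no meaning.
\<close>

definition cayley_defined :: "('n::finite, 'm::finite) linsys \<Rightarrow> real^'m^'m \<Rightarrow> bool" where
  "cayley_defined S R \<longleftrightarrow> invertible (matD S + R)"

definition cayley :: "('n::finite, 'm::finite) linsys \<Rightarrow> real^'m^'m \<Rightarrow> ('n, 'm) linsys" where
  "cayley S R =
     (let E = matrix_inv (matD S + R); Q = mat_sqrt R in
      LinSys
        (matA S - matB S ** E ** matC S)
        (sqrt 2 *\<^sub>R (matB S ** E ** Q))
        (sqrt 2 *\<^sub>R (Q ** E ** matC S))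
        (mat 1 - 2 *\<^sub>R (Q ** E ** Q)))"


definition Delta1 ::
  "('n::finite, 'k::finite + 'k) linsys \<Rightarrow> ('q::finite, 'k + 'k) linsys \<Rightarrow> real^'k^'k" where
  "Delta1 P Q = mat 1 - row2 (col2 (matD P)) ** row1 (col1 (matD Q))"

definition Delta2 ::
  "('n::finite, 'k::finite + 'k) linsys \<Rightarrow> ('q::finite, 'k + 'k) linsys \<Rightarrow> real^'k^'k" where
  "Delta2 P Q = mat 1 - row1 (col1 (matD Q)) ** row2 (col2 (matD P))"

definition well_posed ::
  "('n::finite, 'k::finite + 'k) linsys \<Rightarrow> ('q::finite, 'k + 'k) linsys \<Rightarrow> bool" where
  "well_posed P Q \<longleftrightarrow> invertible (Delta1 P Q) \<and> invertible (Delta2 P Q)"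

text \<open>
  The star product exists exactly if \<open>well_posed P Q\<close> holds; otherwise the value of
  \<open>star P Q\<close> has no meaning. The external input is \<open>(u\<^sub>1, u'\<^sub>2)\<close>, the external output
  \<open>(y\<^sub>1, y'\<^sub>2)\<close>, and the state is the state of \<open>P\<close> followed by that of \<open>Q\<close>.
\<close>

definition star ::
  "('n::finite, 'k::finite + 'k) linsys \<Rightarrow> ('q::finite, 'k + 'k) linsys \<Rightarrow>
   ('n + 'q, 'k + 'k) linsys" where
  "star P Q =
     (let Ap = matA P; Bp1 = col1 (matB P); Bp2 = col2 (matB P);
          Cp1 = row1 (matC P); Cp2 = row2 (matC P);
          Dp11 = row1 (col1 (matD P)); Dp12 = row1 (col2 (matD P));
          Dp21 = row2 (col1 (matD P)); Dp22 = row2 (col2 (matD P));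
          Aq = matA Q; Bq1 = col1 (matB Q); Bq2 = col2 (matB Q);
          Cq1 = row1 (matC Q); Cq2 = row2 (matC Q);
          Dq11 = row1 (col1 (matD Q)); Dq12 = row1 (col2 (matD Q));
          Dq21 = row2 (col1 (matD Q)); Dq22 = row2 (col2 (matD Q));
          E1 = matrix_inv (Delta1 P Q); E2 = matrix_inv (Delta2 P Q)
      in LinSys
        (block_mat
          (Ap + Bp2 ** E2 ** Dq11 ** Cp2)  (Bp2 ** E2 ** Cq1)
          (Bq1 ** E1 ** Cp2)               (Aq + Bq1 ** E1 ** Dp22 ** Cq1))
        (block_mat
          (Bp1 + Bp2 ** E2 ** Dq11 ** Dp21)  (Bp2 ** E2 ** Dq12)
          (Bq1 ** E1 ** Dp21)                (Bq2 + Bq1 ** E1 ** Dp22 ** Dq12))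
        (block_mat
          (Cp1 + Dp12 ** E2 ** Dq11 ** Cp2)  (Dp12 ** E2 ** Cq1)
          (Dq21 ** E1 ** Cp2)                (Cq2 + Dq21 ** E1 ** Dp22 ** Cq1))
        (block_mat
          (Dp11 + Dp12 ** E2 ** Dq11 ** Dp21)  (Dp12 ** E2 ** Dq12)
          (Dq21 ** E1 ** Dp21)                 (Dq22 + Dq21 ** E1 ** Dp22 ** Dq12)))"

end

theory Submission
  imports Defs
begin

text \<open>
  A signal of the external Cayley transform is a signal of the original system in which
  the current \<open>w\<close> and the voltage at each port are replaced by the incoming wave \<open>v\<close> and the
  outgoing wave. The identity \<open>wave_power_balance\<close> says that \<open>|v|\<^sup>2\<close> minus the squared norm of
  the outgoing wave is twice the product of current and voltage. Since the state is unchanged,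
  impedance passivity of a system and scattering passivity of its transform are the same
  inequality, read in two coordinate systems.

  The change of coordinates from scattering to impedance variables is possible precisely if \<open>1\<close> is
  not an eigenvalue of the feedthrough matrix \<open>D\<close>. The theorem therefore amounts to two facts about
  the feedthrough matrices of the transformed systems: the loop matrices are invertible
  (\<open>well_posed_of_contractions\<close>), and \<open>1\<close> is not an eigenvalue of the feedthrough matrix of the star
  product (\<open>star_feedthrough_fixed_point\<close>). Both use that the two matrices are contractions, and that the
  one of a properly impedance passive system is a strict contraction
  (\<open>cayley_feedthrough_strict_contraction\<close>): a signal that circulates in the loop without loss must
  vanish in the strictly contractive component. In the other component only a fixed point of its
  feedthrough matrix could then remain, and it vanishes as well
  (\<open>cayley_feedthrough_fixed_point\<close>). Scattering passivity of the
  star product (\<open>scattering_passive_star\<close>) holds as the power exchanged in the loop cancels, and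
  \<open>scattering_passive_imp_cayley_of_impedance_passive\<close> produces the desired impedance passive system.

  Two analytic ingredients underlie this algebra. Passivity is defined along trajectories, and
  \<open>dissipation_along_trajectories_iff\<close> turns it into a pointwise inequality by exhibiting a trajectory
  through every state and input value. The transform involves the positive square root of \<open>R\<close>; its
  existence comes from a fixed point argument (\<open>contraction_sqrt_exists\<close>) and its uniqueness from a
  trace computation (\<open>positive_sqrt_unique\<close>).
\<close>

section \<open>Positive matrices and their square roots\<close>

lemma matrix_inv_mult_vector:
  fixes M :: "real^'n^'n"
  assumes "invertible M"
  shows "matrix_inv M *v (M *v x) = x" and "M *v (matrix_inv M *v x) = x"
proof -
  have "M ** matrix_inv M = mat 1 \<and> matrix_inv M ** M = mat 1"
    unfolding matrix_inv_def using assms unfolding invertible_def by (rule someI_ex)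
  then show "matrix_inv M *v (M *v x) = x" "M *v (matrix_inv M *v x) = x"
    by (auto simp: matrix_vector_mul_assoc)
qed

lemma invertible_iff_ker:
  fixes M :: "real^'n^'n"
  shows "invertible M \<longleftrightarrow> (\<forall>x. M *v x = 0 \<longrightarrow> x = 0)"
  by (simp add: invertible_left_inverse matrix_left_invertible_ker)

lemma symmetric_inner:
  fixes M :: "real^'n^'n"
  assumes "transpose M = M"
  shows "x \<bullet> (M *v y) = (M *v x) \<bullet> y"
  by (metis assms dot_lmul_matrix transpose_matrix_vector)

lemma symmetricI:
  fixes M :: "real^'n^'n"
  assumes "\<And>x y. x \<bullet> (M *v y) = (M *v x) \<bullet> y"
  shows "transpose M = M"
proof -
  have "M $ i $ j = M $ j $ i" for i j
    using assms[of "axis i 1" "axis j 1"]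
    by (simp add: matrix_vector_mult_basis inner_axis inner_axis' column_def)
  then show ?thesis
    by (simp add: transpose_def vec_eq_iff)
qed

text \<open>
  A positive matrix satisfies \<open>M\<^sup>2 \<le> K M\<close> whenever \<open>K\<close> bounds its operator norm.
  For invertible \<open>M\<close>, definiteness follows from this, and so does a norm bound strictly below one
  for \<open>1 - M/K\<close>.
\<close>

lemma norm_mult_positive_le:
  fixes M :: "real^'n^'n"
  assumes "positive_mat M"
  obtains K where "K > 0" "\<And>x. norm (M *v x) \<le> K * norm x"
    "\<And>x. (norm (M *v x))\<^sup>2 \<le> K * (x \<bullet> (M *v x))"
proof -
  obtain K where K: "K > 0" "\<And>x. norm (M *v x) \<le> norm x * K"
    using bounded_linear.pos_bounded[OF matrix_vector_mul_bounded_linear[of M]] by blast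
  have "(norm (M *v x))\<^sup>2 \<le> K * (x \<bullet> (M *v x))" for x
  proof -
    let ?y = "M *v x"
    have sym: "transpose M = M" and pos: "\<And>z. 0 \<le> z \<bullet> (M *v z)"
      using assms by (auto simp: positive_mat_def)
    have yy: "x \<bullet> (M *v ?y) = (norm ?y)\<^sup>2"
      by (simp add: symmetric_inner[OF sym] power2_norm_eq_inner)
    (* Positivity at x - t M x gives the claim for t = 1/K, where the bound is sharpest. *)
    have "0 \<le> (x - (1/K) *\<^sub>R ?y) \<bullet> (M *v (x - (1/K) *\<^sub>R ?y))"
      by (rule pos)
    also have "\<dots> = x \<bullet> ?y - 2/K * (norm ?y)\<^sup>2 + (1/K)\<^sup>2 * (?y \<bullet> (M *v ?y))"
      using yy by (simp add: matrix_vector_mult_diff_distrib matrix_vector_mult_scaleR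
          inner_diff_left inner_diff_right power2_eq_square[of K] power2_norm_eq_inner
          power_divide diff_divide_distrib field_simps)
    also have "?y \<bullet> (M *v ?y) \<le> K * (norm ?y)\<^sup>2"
      using norm_cauchy_schwarz[of ?y "M *v ?y"] K(2)[of ?y]
        mult_left_mono[OF K(2)[of ?y] norm_ge_zero[of ?y]]
      by (simp add: power2_eq_square algebra_simps)
    then have "(1/K)\<^sup>2 * (?y \<bullet> (M *v ?y)) \<le> (1/K)\<^sup>2 * (K * (norm ?y)\<^sup>2)"
      by (rule mult_left_mono) simp
    finally show ?thesis
      using K(1) by (simp add: field_simps power2_eq_square)
  qed
  with K show thesis
    by (intro that[of K]) (auto simp: mult.commute)
qed

lemma positive_invertible_imp_definite:
  fixes M :: "real^'n^'n"
  assumes "positive_mat M" "invertible M" "x \<noteq> 0"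
  shows "0 < x \<bullet> (M *v x)"
proof -
  obtain K where K: "K > 0" "(norm (M *v x))\<^sup>2 \<le> K * (x \<bullet> (M *v x))"
    using norm_mult_positive_le[OF assms(1)] by metis
  have "M *v x \<noteq> 0"
    using assms invertible_iff_ker by blast
  then have "0 < K * (x \<bullet> (M *v x))"
    using K(2) by (smt (verit) zero_less_norm_iff zero_less_power)
  then show ?thesis
    using K(1) by (simp add: zero_less_mult_iff)
qed

text \<open>
  The cross term \<open>- 2 (x \<bullet> M x)/K\<close> of the expanded square is at most \<open>- 2 |M x|\<^sup>2/K\<^sup>2\<close>, so the
  squared norm drops by at least \<open>|M x|\<^sup>2/K\<^sup>2\<close>; invertibility bounds \<open>|M x|\<close> below.
\<close>

lemma id_minus_scaled_contraction:
  fixes M :: "real^'n^'n"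
  assumes "positive_mat M" "invertible M"
  obtains K \<rho> where "K > 0" "0 \<le> \<rho>" "\<rho> < 1" "\<And>x. norm (x - (1/K) *\<^sub>R (M *v x)) \<le> \<rho> * norm x"
proof -
  obtain K where K: "K > 0" "\<And>x. norm (M *v x) \<le> K * norm x"
    "\<And>x. (norm (M *v x))\<^sup>2 \<le> K * (x \<bullet> (M *v x))"
    using norm_mult_positive_le[OF assms(1)] by metis
  have "inj ((*v) M)"
    using assms(2) by (simp add: inj_matrix_vector_mult)
  then obtain b where b: "b > 0" "\<And>x. b * norm x \<le> norm (M *v x)"
    using linear_inj_bounded_below_pos[OF matrix_vector_mul_linear[of M]] by metis
  define r where "r = max 0 (1 - (b/K)\<^sup>2)"
  have r: "0 \<le> r" "r < 1"
    using b K by (auto simp: r_def)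
  have "norm (x - (1/K) *\<^sub>R (M *v x)) \<le> sqrt r * norm x" for x
  proof -
    let ?y = "M *v x"
    have "(norm (x - (1/K) *\<^sub>R ?y))\<^sup>2 = (norm x)\<^sup>2 - 2/K * (x \<bullet> ?y) + (1/K)\<^sup>2 * (norm ?y)\<^sup>2"
      by (simp add: power2_norm_eq_inner inner_diff_left inner_diff_right
          power2_eq_square[of K] power_divide inner_commute field_simps)
    also have "\<dots> \<le> (norm x)\<^sup>2 - (1/K)\<^sup>2 * (norm ?y)\<^sup>2"
      using K(3)[of x] K(1) by (simp add: field_simps power2_eq_square)
    also have "\<dots> \<le> (norm x)\<^sup>2 - (1/K)\<^sup>2 * (b * norm x)\<^sup>2"
      using b K(1) by (intro diff_left_mono mult_left_mono power_mono) auto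
    also have "\<dots> = (1 - (b/K)\<^sup>2) * (norm x)\<^sup>2"
      by (simp add: field_simps power2_eq_square)
    also have "\<dots> \<le> r * (norm x)\<^sup>2"
      by (intro mult_right_mono) (auto simp: r_def)
    finally have "norm (x - (1/K) *\<^sub>R ?y) \<le> sqrt (r * (norm x)\<^sup>2)"
      by (rule real_le_rsqrt)
    then show ?thesis
      by (simp add: real_sqrt_mult)
  qed
  with r K(1) show thesis
    by (intro that[of K "sqrt r"]) auto
qed

text \<open>
  If \<open>Y = (S + Y\<^sup>2)/2\<close>, then \<open>(1 - Y)\<^sup>2 = 1 - S\<close>, so a fixed point of \<open>Y \<mapsto> (S + Y\<^sup>2)/2\<close> yields
  a square root of \<open>1 - S\<close>. On the symmetric operators of norm at most \<open>\<rho> < 1\<close> this map is a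
  contraction with constant \<open>\<rho>\<close>, and Banach's theorem applies. The setting is that of
  bounded operators because the Euclidean norm of the entries of \<open>S\<close> may exceed one even when the
  operator norm does not.
\<close>

lemma contraction_sqrt_exists:
  fixes S :: "(real^'n) \<Rightarrow>\<^sub>L (real^'n)"
  assumes "norm S \<le> \<rho>" "0 \<le> \<rho>" "\<rho> < 1" and S_sym: "\<And>x y. x \<bullet> S y = S x \<bullet> y"
  obtains Y :: "(real^'n) \<Rightarrow>\<^sub>L (real^'n)" where "norm Y \<le> \<rho>" "\<And>x y. x \<bullet> Y y = Y x \<bullet> y" "\<And>x. 2 *\<^sub>R Y x = S x + Y (Y x)"
proof -
  define F where "F Y = (1/2) *\<^sub>R (S + (Y o\<^sub>L Y))" for Y :: "(real^'n) \<Rightarrow>\<^sub>L (real^'n)"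
  define C where "C = {Y :: (real^'n) \<Rightarrow>\<^sub>L (real^'n). norm Y \<le> \<rho>} \<inter> {Y. \<forall>x y. x \<bullet> blinfun_apply Y y = blinfun_apply Y x \<bullet> y}"
  have "closed {Y :: (real^'n) \<Rightarrow>\<^sub>L (real^'n). norm Y \<le> \<rho>}"
    by (rule closed_Collect_le) (intro continuous_intros)+
  moreover have "closed {Y :: (real^'n) \<Rightarrow>\<^sub>L (real^'n). x \<bullet> Y y = Y x \<bullet> y}" for x y
    by (rule closed_Collect_eq) (intro continuous_intros)+
  ultimately have "closed C"
    unfolding C_def by (intro closed_Int closed_Collect_all)
  then have "complete C"
    by (simp add: complete_eq_closed)
  moreover have "C \<noteq> {}"
  proof -
    have "0 \<in> C"
      using assms(2) by (simp add: C_def)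
    then show ?thesis by blast
  qed
  moreover have "F ` C \<subseteq> C"
  proof
    fix Z assume "Z \<in> F ` C"
    then obtain Y :: "(real^'n) \<Rightarrow>\<^sub>L (real^'n)" where Y: "norm Y \<le> \<rho>" "\<And>x y. x \<bullet> Y y = Y x \<bullet> y" and Z: "Z = F Y"
      by (auto simp: C_def)
    have "norm (Y o\<^sub>L Y) \<le> \<rho> * \<rho>"
      by (rule order_trans[OF norm_blinfun_compose]) (use Y(1) in \<open>auto intro: mult_mono'\<close>)
    also have "\<dots> \<le> \<rho>"
      using assms by (simp add: mult_left_le)
    finally have "norm (S + (Y o\<^sub>L Y)) \<le> \<rho> + \<rho>"
      using assms(1) norm_triangle_ineq[of S "Y o\<^sub>L Y"] by linarith
    then have "norm Z \<le> \<rho>"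
      by (simp add: Z F_def)
    moreover have "x \<bullet> Z y = Z x \<bullet> y" for x y
      using Y(2)[of x "Y y"] Y(2)[of "Y x" y] S_sym[of x y]
      by (simp add: Z F_def blinfun.bilinear_simps inner_add_left inner_add_right)
    ultimately show "Z \<in> C"
      by (simp add: C_def)
  qed
  moreover have "dist (F Y) (F Z) \<le> \<rho> * dist Y Z" if "Y \<in> C" "Z \<in> C" for Y Z
  proof -
    have nY: "norm Y \<le> \<rho>" and nZ: "norm Z \<le> \<rho>"
      using that by (auto simp: C_def)
    have "F Y - F Z = (1/2) *\<^sub>R ((Y o\<^sub>L (Y - Z)) + ((Y - Z) o\<^sub>L Z))"
      by (rule blinfun_eqI) (simp add: F_def blinfun.bilinear_simps algebra_simps)
    then have "dist (F Y) (F Z) = norm ((Y o\<^sub>L (Y - Z)) + ((Y - Z) o\<^sub>L Z)) / 2"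
      by (simp add: dist_norm)
    also have "\<dots> \<le> (norm Y * norm (Y - Z) + norm (Y - Z) * norm Z) / 2"
      by (intro divide_right_mono order_trans[OF norm_triangle_ineq] add_mono norm_blinfun_compose) simp
    also have "\<dots> \<le> (\<rho> * norm (Y - Z) + norm (Y - Z) * \<rho>) / 2"
      using nY nZ assms(2) by (intro divide_right_mono add_mono mult_mono) auto
    finally show ?thesis
      by (simp add: dist_norm)
  qed
  ultimately obtain Y where Y: "Y \<in> C" "F Y = Y"
    using Banach_fix[of C \<rho> F] assms by blast
  have "2 *\<^sub>R Y x = S x + Y (Y x)" for x
  proof -
    have "2 *\<^sub>R Y x = 2 *\<^sub>R F Y x"
      using Y(2) by simp
    then show ?thesis
      by (simp add: F_def blinfun.bilinear_simps)
  qed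
  with Y(1) show thesis
    by (intro that[of Y]) (auto simp: C_def)
qed

text \<open>
  Scaling by \<open>K\<close> reduces to the square root of \<open>1 - S\<close> with \<open>S = 1 - R/K\<close>; the root \<open>1 - Y\<close> is
  positive because the norm of \<open>Y\<close> is below one.
\<close>

lemma positive_sqrt_exists:
  fixes R :: "real^'n^'n"
  assumes "positive_mat R" "invertible R"
  obtains Q where "positive_mat Q" "Q ** Q = R"
proof -
  obtain K \<rho> where K: "K > 0" "0 \<le> \<rho>" "\<rho> < 1"
    and contr: "\<And>x. norm (x - (1/K) *\<^sub>R (R *v x)) \<le> \<rho> * norm x"
    using id_minus_scaled_contraction[OF assms] by metis
  have sym: "transpose R = R"
    using assms(1) by (simp add: positive_mat_def)
  define S where "S = Blinfun (\<lambda>x. x - (1/K) *\<^sub>R (R *v x))"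
  have S: "S x = x - (1/K) *\<^sub>R (R *v x)" for x
    unfolding S_def
    by (subst bounded_linear_Blinfun_apply) (auto intro!: bounded_linear_intros)
  have "norm S \<le> \<rho>"
    using K contr by (intro norm_blinfun_bound) (auto simp: S)
  moreover have "x \<bullet> S y = S x \<bullet> y" for x y
    by (simp add: S inner_diff_left inner_diff_right symmetric_inner[OF sym])
  ultimately obtain Y :: "(real^'n) \<Rightarrow>\<^sub>L (real^'n)" where Y: "norm Y \<le> \<rho>" "\<And>x y. x \<bullet> Y y = Y x \<bullet> y"
      "\<And>x. 2 *\<^sub>R Y x = S x + Y (Y x)"
    using contraction_sqrt_exists[of S \<rho>] K by metis
  define Q where "Q = matrix (\<lambda>x. sqrt K *\<^sub>R (x - Y x))"
  have "linear (\<lambda>x. sqrt K *\<^sub>R (x - Y x))"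
    by (intro linearI) (auto simp: blinfun.bilinear_simps algebra_simps)
  then have Q: "Q *v x = sqrt K *\<^sub>R (x - Y x)" for x
    unfolding Q_def by (simp add: matrix_works)
  have "0 \<le> x \<bullet> (Q *v x)" for x
  proof -
    have "x \<bullet> Y x \<le> norm x * norm (Y x)"
      by (rule norm_cauchy_schwarz)
    also have "norm (Y x) \<le> 1 * norm x"
      using Y(1) K(3) by (intro order_trans[OF norm_blinfun mult_right_mono]) auto
    then have "norm x * norm (Y x) \<le> norm x * (1 * norm x)"
      by (rule mult_left_mono) simp
    finally show ?thesis
      using K(1) by (simp add: Q inner_diff_right power2_norm_eq_inner[symmetric] power2_eq_square)
  qed
  moreover have "transpose Q = Q"
    by (rule symmetricI) (simp add: Q inner_diff_left inner_diff_right Y(2))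
  moreover have "(Q ** Q) *v x = R *v x" for x
  proof -
    have "(Q ** Q) *v x = K *\<^sub>R (x - 2 *\<^sub>R Y x + Y (Y x))"
      using K(1) by (simp add: matrix_vector_mul_assoc[symmetric] Q blinfun.bilinear_simps
          algebra_simps scaleR_2)
    also have "\<dots> = R *v x"
      using K(1) by (simp add: Y(3) S)
    finally show ?thesis .
  qed
  ultimately show thesis
    by (intro that[of Q]) (auto simp: positive_mat_def matrix_eq)
qed

lemma trace_eq_sum_inner: "trace (M :: real^'n^'n) = (\<Sum>i\<in>UNIV. axis i 1 \<bullet> (M *v axis i 1))"
  by (simp add: trace_def matrix_vector_mult_basis inner_axis' column_def)

text \<open>
  With \<open>D = S - T\<close> the hypothesis reads \<open>S D + D T = 0\<close>. Multiplying by \<open>D\<close> and taking traces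
  gives \<open>tr (D S D) + tr (D T D) = 0\<close>, where both traces are nonnegative as \<open>D\<close> is symmetric.
  Hence \<open>tr (D S D)\<close>, the sum of \<open>d \<bullet> S d\<close> over the columns \<open>d\<close> of \<open>D\<close>, vanishes, and
  definiteness of \<open>S\<close> forces every column to be zero.
\<close>

lemma positive_sqrt_unique:
  fixes S T :: "real^'n^'n"
  assumes S: "positive_mat S" "invertible S" and T: "positive_mat T" and eq: "S ** S = T ** T"
  shows "S = T"
proof -
  define D where "D = S - T"
  have sym: "transpose S = S" "transpose T = T" "transpose D = D"
    using S T by (auto simp: positive_mat_def D_def transpose_def vec_eq_iff)
  have SDDT: "S ** D + D ** T = 0"
    using eq unfolding matrix_eq
    by (simp add: D_def matrix_vector_mult_diff_distrib matrix_vector_mult_diff_rdistrib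
        matrix_vector_mult_add_rdistrib flip: matrix_vector_mul_assoc)
  have "trace (D ** S ** D) + trace (D ** T ** D) = trace (D ** (S ** D + D ** T))"
    by (simp add: matrix_add_ldistrib trace_add matrix_mul_assoc trace_mul_sym[of "D ** T" D])
  also have "\<dots> = 0"
    by (simp add: SDDT trace_def)
  finally have tr: "trace (D ** S ** D) + trace (D ** T ** D) = 0" .
  let ?d = "\<lambda>i. D *v axis i 1"
  have tr_form: "trace (D ** M ** D) = (\<Sum>i\<in>UNIV. ?d i \<bullet> (M *v ?d i))" for M :: "real^'n^'n"
    by (simp add: trace_eq_sum_inner matrix_vector_mul_assoc[symmetric] symmetric_inner[OF sym(3)])
  have "0 \<le> trace (D ** T ** D)"
    using T by (auto simp: tr_form positive_mat_def intro: sum_nonneg)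
  with tr have "(\<Sum>i\<in>UNIV. ?d i \<bullet> (S *v ?d i)) \<le> 0"
    by (simp add: tr_form)
  moreover have nn: "0 \<le> ?d i \<bullet> (S *v ?d i)" for i
    using S by (simp add: positive_mat_def)
  ultimately have "(\<Sum>i\<in>UNIV. ?d i \<bullet> (S *v ?d i)) = 0"
    by (meson antisym sum_nonneg)
  then have "?d i \<bullet> (S *v ?d i) = 0" for i
    using nn by (simp add: sum_nonneg_eq_0_iff)
  then have "?d i = 0" for i
    using positive_invertible_imp_definite[OF S] by (metis less_irrefl)
  then have "D = 0"
    by (simp add: vec_eq_iff matrix_vector_mult_basis column_def)
  then show ?thesis
    by (simp add: D_def)
qed

lemma mat_sqrt_properties:
  fixes R :: "real^'n^'n"
  assumes "positive_mat R" "invertible R"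
  shows "positive_mat (mat_sqrt R)" and "mat_sqrt R ** mat_sqrt R = R" and "invertible (mat_sqrt R)"
proof -
  have inv: "invertible T" if "T ** T = R" for T
    unfolding invertible_iff_ker
  proof (intro allI impI)
    fix x assume "T *v x = 0"
    then have "R *v x = 0"
      using that by (metis matrix_vector_mul_assoc matrix_vector_mult_0_right)
    then show "x = 0"
      using assms(2) invertible_iff_ker by blast
  qed
  obtain Q where Q: "positive_mat Q" "Q ** Q = R"
    using positive_sqrt_exists[OF assms] .
  have "positive_mat (mat_sqrt R) \<and> mat_sqrt R ** mat_sqrt R = R"
    unfolding mat_sqrt_def
  proof (rule theI[of _ Q])
    show "positive_mat Q \<and> Q ** Q = R"
      using Q by simp
    show "T = Q" if "positive_mat T \<and> T ** T = R" for T
      using that Q inv[of T] positive_sqrt_unique[of T Q] by metis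
  qed
  then show "positive_mat (mat_sqrt R)" "mat_sqrt R ** mat_sqrt R = R" "invertible (mat_sqrt R)"
    using inv by auto
qed


section \<open>Passivity as a pointwise dissipation inequality\<close>

lemma has_vector_derivative_vecI:
  fixes f :: "real \<Rightarrow> real^'n"
  assumes "\<And>i. ((\<lambda>t. f t $ i) has_real_derivative (f' $ i)) (at t within T)"
  shows "(f has_vector_derivative f') (at t within T)"
proof -
  have "((\<lambda>t. f t \<bullet> b) has_derivative (\<lambda>t. (t *\<^sub>R f') \<bullet> b)) (at t within T)" if "b \<in> Basis" for b
  proof -
    obtain i where "b = axis i 1"
      using \<open>b \<in> Basis\<close> by (auto simp: Basis_vec_def)
    then show ?thesis
      using assms[of i] by (simp add: inner_axis has_field_derivative_def mult_commute_abs)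
  qed
  then show ?thesis
    unfolding has_vector_derivative_def by (subst has_derivative_componentwise_within) blast
qed

text \<open>
  The solution is the power series with coefficients \<open>a\<^sub>0 = x\<^sub>0\<close>,
  \<open>a\<^sub>k\<^sub>+\<^sub>1 = A\<^sup>k (A x\<^sub>0 + b) / (k + 1)!\<close>, dominated by an exponential series and
  differentiated entry by entry.
\<close>

lemma affine_ode_solution:
  fixes A :: "real^'n^'n" and b x\<^sub>0 :: "real^'n"
  obtains x where "x 0 = x\<^sub>0" "\<And>t. (x has_vector_derivative (A *v x t + b)) (at t)"
proof -
  define v where "v = A *v x\<^sub>0 + b"
  define w where "w k = (((*v) A) ^^ k) v" for k
  define a where "a k = (case k of 0 \<Rightarrow> x\<^sub>0 | Suc l \<Rightarrow> (1 / fact (Suc l)) *\<^sub>R w l)" for k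
  have rec: "real (Suc k) *\<^sub>R a (Suc k) = A *v a k + (if k = 0 then b else 0)" for k
  proof (cases k)
    case (Suc l)
    have "real (Suc k) *\<^sub>R a (Suc k) = (1 / fact k) *\<^sub>R w k"
      by (simp add: a_def del: of_nat_Suc)
    then show ?thesis
      by (simp add: Suc a_def w_def matrix_vector_mult_scaleR)
  qed (simp add: a_def w_def v_def)
  obtain K\<^sub>0 where K0: "\<And>x. norm (A *v x) \<le> norm x * K\<^sub>0"
    using bounded_linear.pos_bounded[OF matrix_vector_mul_bounded_linear[of A]] by blast
  (* K at least 1 makes its powers monotone, which absorbs the index shift in the coefficients. *)
  define K where "K = max 1 K\<^sub>0"
  have K: "1 \<le> K" "norm (A *v x) \<le> K * norm x" for x
    using K0[of x] mult_left_mono[of K\<^sub>0 K "norm x"] by (auto simp: K_def mult.commute)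
  define M where "M = norm x\<^sub>0 + norm v"
  have w: "norm (w k) \<le> K ^ k * norm v" for k
  proof (induction k)
    case (Suc k)
    have "norm (w (Suc k)) \<le> K * norm (w k)"
      by (simp add: w_def K)
    also have "\<dots> \<le> K * (K ^ k * norm v)"
      using Suc K(1) by (intro mult_left_mono) auto
    finally show ?case
      by (simp add: mult.assoc)
  qed (simp add: w_def)
  have a: "norm (a k) \<le> M * K ^ k / fact k" for k
  proof (cases k)
    case (Suc l)
    have "norm (w l) \<le> K ^ l * norm v"
      by (rule w)
    also have "\<dots> \<le> K ^ k * M"
      using K(1) by (intro mult_mono power_increasing) (auto simp: Suc M_def)
    finally have "norm (w l) / fact k \<le> K ^ k * M / fact k"
      by (rule divide_right_mono) simp
    moreover have "norm (a k) = norm (w l) / fact k"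
      by (simp add: Suc a_def divide_inverse del: fact_Suc)
    ultimately show ?thesis
      by (simp add: mult.commute)
  qed (simp add: a_def M_def)
  have summable: "summable (\<lambda>k. a k $ i * t ^ k)" for i t
  proof (rule summable_comparison_test')
    show "summable (\<lambda>k. M * ((K * \<bar>t\<bar>) ^ k /\<^sub>R fact k))"
      by (intro summable_mult summable_exp_generic)
    show "norm (a k $ i * t ^ k) \<le> M * ((K * \<bar>t\<bar>) ^ k /\<^sub>R fact k)" for k
    proof -
      have "norm (a k $ i * t ^ k) \<le> norm (a k) * \<bar>t\<bar> ^ k"
        by (simp add: abs_mult power_abs mult_right_mono component_le_norm_cart)
      also have "\<dots> \<le> (M * K ^ k / fact k) * \<bar>t\<bar> ^ k"
        by (intro mult_right_mono a) simp
      finally show ?thesis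
        by (simp add: power_mult_distrib field_simps)
    qed
  qed
  define x where "x t = (\<chi> i. \<Sum>k. a k $ i * t ^ k)" for t
  have x: "(\<lambda>k. a k $ i * t ^ k) sums (x t $ i)" for i t
    using summable by (simp add: x_def summable_sums)
  have "(x has_vector_derivative (A *v x t + b)) (at t)" for t
  proof (rule has_vector_derivative_vecI)
    fix i
    let ?c = "\<lambda>k. a k $ i"
    have "(\<lambda>k. \<Sum>j\<in>UNIV. A $ i $ j * (a k $ j * t ^ k)) sums (\<Sum>j\<in>UNIV. A $ i $ j * x t $ j)"
      by (intro sums_sum sums_mult x)
    moreover have "(\<lambda>k. if k = 0 then b $ i else 0) sums b $ i"
      using sums_single[of 0 "\<lambda>_. b $ i"] by simp
    ultimately have "(\<lambda>k. (\<Sum>j\<in>UNIV. A $ i $ j * (a k $ j * t ^ k)) + (if k = 0 then b $ i else 0))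
        sums ((A *v x t + b) $ i)"
      by (simp add: matrix_vector_mult_def sums_add)
    moreover have "diffs ?c k * t ^ k =
        (\<Sum>j\<in>UNIV. A $ i $ j * (a k $ j * t ^ k)) + (if k = 0 then b $ i else 0)" for k
    proof -
      have "diffs ?c k = (A *v a k + (if k = 0 then b else 0)) $ i"
        by (simp add: diffs_def del: of_nat_Suc flip: rec)
      then show ?thesis
        by (simp add: matrix_vector_mult_def sum_distrib_right distrib_right mult.assoc)
    qed
    ultimately have "(\<lambda>k. diffs ?c k * t ^ k) sums ((A *v x t + b) $ i)"
      by simp
    then have "(\<Sum>k. diffs ?c k * t ^ k) = (A *v x t + b) $ i"
      by (rule sums_unique[symmetric])
    moreover have "((\<lambda>t. \<Sum>k. ?c k * t ^ k) has_field_derivative (\<Sum>k. diffs ?c k * t ^ k)) (at t)"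
      by (rule termdiffs_strong_converges_everywhere) (rule summable)
    ultimately show "((\<lambda>t. x t $ i) has_real_derivative (A *v x t + b) $ i) (at t)"
      by (simp add: x_def)
  qed
  moreover have "x 0 = x\<^sub>0"
    by (simp add: x_def vec_eq_iff a_def)
  ultimately show thesis
    using that by blast
qed

lemma norm_squared_derivative:
  fixes x :: "real \<Rightarrow> real^'n"
  assumes "(x has_vector_derivative x') (at t within I)"
  shows "((\<lambda>s. (norm (x s))\<^sup>2) has_real_derivative 2 * (x t \<bullet> x')) (at t within I)"
proof -
  have "((\<lambda>s. x s \<bullet> x s) has_derivative (\<lambda>h. x t \<bullet> (h *\<^sub>R x') + (h *\<^sub>R x') \<bullet> x t)) (at t within I)"
    using assms unfolding has_vector_derivative_def by (intro has_derivative_inner)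
  moreover have "(\<lambda>h. x t \<bullet> (h *\<^sub>R x') + (h *\<^sub>R x') \<bullet> x t) = (*) (2 * (x t \<bullet> x'))"
    by (auto simp: inner_commute)
  ultimately show ?thesis
    by (simp add: has_field_derivative_def power2_norm_eq_inner)
qed

text \<open>
  Every state \<open>x\<close> and input value \<open>u\<close> occur together on some trajectory: take the constant input
  and solve the resulting affine equation through \<open>x\<close>. A dissipation inequality with any supply
  rate \<open>s\<close> along all trajectories is therefore an algebraic inequality in \<open>x\<close> and \<open>u\<close>. Both kinds
  of passivity are instances.
\<close>

lemma dissipation_along_trajectories_iff:
  fixes S :: "('n::finite, 'm::finite) linsys" and s :: "real^'m \<Rightarrow> real^'m \<Rightarrow> real"
  shows "(\<forall>I u x y. is_interval I \<and> interior I \<noteq> {} \<and> trajectory S I u x y \<longrightarrow>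
            (\<forall>t\<in>I. \<exists>d. ((\<lambda>s. (norm (x s))\<^sup>2) has_real_derivative d) (at t within I) \<and>
                      d \<le> s (u t) (y t)))
     \<longleftrightarrow> (\<forall>x u. 2 * (x \<bullet> (matA S *v x + matB S *v u)) \<le> s u (matC S *v x + matD S *v u))"
    (is "?traj \<longleftrightarrow> ?alg")
proof
  assume ?traj
  show ?alg
  proof (intro allI)
    fix x\<^sub>0 :: "real^'n" and u\<^sub>0 :: "real^'m"
    let ?f = "matA S *v x\<^sub>0 + matB S *v u\<^sub>0" and ?g = "matC S *v x\<^sub>0 + matD S *v u\<^sub>0"
    obtain x where x: "x 0 = x\<^sub>0"
      "\<And>t. (x has_vector_derivative (matA S *v x t + matB S *v u\<^sub>0)) (at t)"
      using affine_ode_solution by blast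
    have "trajectory S UNIV (\<lambda>_. u\<^sub>0) x (\<lambda>t. matC S *v x t + matD S *v u\<^sub>0)"
      using x(2) by (simp add: trajectory_def)
    then obtain d where d: "((\<lambda>s. (norm (x s))\<^sup>2) has_real_derivative d) (at 0)" "d \<le> s u\<^sub>0 ?g"
      using \<open>?traj\<close> x(1) is_interval_univ by fastforce
    have "((\<lambda>s. (norm (x s))\<^sup>2) has_real_derivative 2 * (x\<^sub>0 \<bullet> ?f)) (at 0)"
      using norm_squared_derivative[OF x(2)[of 0]] x(1) by simp
    then have "d = 2 * (x\<^sub>0 \<bullet> ?f)"
      using d(1) DERIV_unique by blast
    then show "2 * (x\<^sub>0 \<bullet> ?f) \<le> s u\<^sub>0 ?g"
      using d(2) by simp
  qed
next
  assume alg: ?alg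
  show ?traj
  proof (intro allI impI ballI)
    fix I u x y t
    assume "is_interval I \<and> interior I \<noteq> {} \<and> trajectory S I u x y" and t: "t \<in> I"
    then have "(x has_vector_derivative (matA S *v x t + matB S *v u t)) (at t within I)"
        and y: "y t = matC S *v x t + matD S *v u t"
      by (auto simp: trajectory_def)
    from norm_squared_derivative[OF this(1)] y alg
    show "\<exists>d. ((\<lambda>s. (norm (x s))\<^sup>2) has_real_derivative d) (at t within I) \<and> d \<le> s (u t) (y t)"
      by (intro exI conjI) (assumption, simp)
  qed
qed

lemma impedance_passive_iff:
  "impedance_passive S \<longleftrightarrow>
    (\<forall>x u. x \<bullet> (matA S *v x + matB S *v u) \<le> u \<bullet> (matC S *v x + matD S *v u))"
  unfolding impedance_passive_def dissipation_along_trajectories_iff[where s = "\<lambda>u y. 2 * (u \<bullet> y)"]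
  by simp

lemma scattering_passive_iff:
  "scattering_passive S \<longleftrightarrow>
    (\<forall>x u. 2 * (x \<bullet> (matA S *v x + matB S *v u))
        \<le> (norm u)\<^sup>2 - (norm (matC S *v x + matD S *v u))\<^sup>2)"
  unfolding scattering_passive_def
  by (rule dissipation_along_trajectories_iff[where s = "\<lambda>u y. (norm u)\<^sup>2 - (norm y)\<^sup>2"])


section \<open>The external Cayley transform and its inverse\<close>

lemmas matrix_action = matrix_vector_mul_assoc[symmetric] scaleR_matrix_vector_assoc[symmetric]
  matrix_vector_mult_scaleR matrix_vector_right_distrib matrix_vector_mult_diff_distrib
  matrix_vector_mult_add_rdistrib matrix_vector_mult_diff_rdistrib

text \<open>
  If \<open>v\<close> is the incoming wave at a port with resistance \<open>Q\<^sup>2\<close> and current \<open>w\<close>, then the outgoing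
  wave is \<open>v - \<surd>2 Q w\<close> and the voltage is \<open>\<surd>2 Q v - Q\<^sup>2 w\<close>. Net incoming wave power equals twice
  current times voltage; this identity exchanges the two supply rates.
\<close>

lemma wave_power_balance:
  fixes Q :: "real^'m^'m"
  assumes "transpose Q = Q"
  shows "(norm v)\<^sup>2 - (norm (v - sqrt 2 *\<^sub>R (Q *v w)))\<^sup>2
    = 2 * (w \<bullet> (sqrt 2 *\<^sub>R (Q *v v) - Q *v (Q *v w)))"
proof -
  have "w \<bullet> (Q *v v) = v \<bullet> (Q *v w)" "w \<bullet> (Q *v (Q *v w)) = (Q *v w) \<bullet> (Q *v w)"
    using symmetric_inner[OF assms] inner_commute by metis+
  then show ?thesis
    by (simp add: power2_norm_eq_inner inner_diff_left inner_diff_right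
        inner_commute[of "Q *v w" v] right_diff_distrib)
qed

lemma impedance_passive_imp_cayley_defined:
  assumes "impedance_passive S" "positive_mat R" "invertible R"
  shows "cayley_defined S R"
  unfolding cayley_defined_def invertible_iff_ker
proof (intro allI impI, rule ccontr)
  fix w assume w: "(matD S + R) *v w = 0" "w \<noteq> 0"
  have "0 \<le> w \<bullet> (matD S *v w)"
    using assms(1)[unfolded impedance_passive_iff, rule_format, of 0 w] by simp
  moreover have "0 < w \<bullet> (R *v w)"
    using positive_invertible_imp_definite assms w(2) by blast
  moreover have "w \<bullet> (matD S *v w) + w \<bullet> (R *v w) = 0"
    using w(1) by (simp add: matrix_action flip: inner_add_right)
  ultimately show False by simp
qed

lemma cayley_sel:
  "matA (cayley S R) = matA S - matB S ** matrix_inv (matD S + R) ** matC S"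
  "matB (cayley S R) = sqrt 2 *\<^sub>R (matB S ** matrix_inv (matD S + R) ** mat_sqrt R)"
  "matC (cayley S R) = sqrt 2 *\<^sub>R (mat_sqrt R ** matrix_inv (matD S + R) ** matC S)"
  "matD (cayley S R) = mat 1 - 2 *\<^sub>R (mat_sqrt R ** matrix_inv (matD S + R) ** mat_sqrt R)"
  by (simp_all add: cayley_def Let_def)

text \<open>
  The transform only changes the external variables: a signal of the transformed system with input
  \<open>v\<close> is a signal of \<open>S\<close> with the same state and with input \<open>w\<close>, and by
  the wave identity above the supply rates agree.
\<close>

lemma cayley_signals:
  fixes S :: "('n::finite, 'm::finite) linsys"
  assumes "cayley_defined S R" "positive_mat R" "invertible R"
    and w: "w = matrix_inv (matD S + R) *v (sqrt 2 *\<^sub>R (mat_sqrt R *v v) - matC S *v x)"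
  shows cayley_state: "matA (cayley S R) *v x + matB (cayley S R) *v v = matA S *v x + matB S *v w"
    and cayley_power: "(norm v)\<^sup>2 - (norm (matC (cayley S R) *v x + matD (cayley S R) *v v))\<^sup>2
      = 2 * (w \<bullet> (matC S *v x + matD S *v w))"
proof -
  let ?Q = "mat_sqrt R"
  have Q: "transpose ?Q = ?Q" "?Q *v (?Q *v z) = R *v z" for z
    using mat_sqrt_properties[OF assms(2,3)]
    by (auto simp: positive_mat_def matrix_vector_mul_assoc)
  show "matA (cayley S R) *v x + matB (cayley S R) *v v = matA S *v x + matB S *v w"
    by (simp add: cayley_sel w matrix_action algebra_simps)
  have out: "matC (cayley S R) *v x + matD (cayley S R) *v v = v - sqrt 2 *\<^sub>R (?Q *v w)"
    by (simp add: cayley_sel w matrix_action algebra_simps)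
  have "(matD S + R) *v w = sqrt 2 *\<^sub>R (?Q *v v) - matC S *v x"
    using assms(1) by (simp add: w cayley_defined_def matrix_inv_mult_vector)
  then have "matC S *v x + matD S *v w = sqrt 2 *\<^sub>R (?Q *v v) - ?Q *v (?Q *v w)"
    by (simp add: Q(2) matrix_action algebra_simps)
  then show "(norm v)\<^sup>2 - (norm (matC (cayley S R) *v x + matD (cayley S R) *v v))\<^sup>2
      = 2 * (w \<bullet> (matC S *v x + matD S *v w))"
    by (simp only: out wave_power_balance[OF Q(1)])
qed

lemma scattering_passive_cayley:
  assumes "impedance_passive S" "positive_mat R" "invertible R"
  shows "scattering_passive (cayley S R)"
  unfolding scattering_passive_iff
proof (intro allI)
  fix x v
  let ?w = "matrix_inv (matD S + R) *v (sqrt 2 *\<^sub>R (mat_sqrt R *v v) - matC S *v x)"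
  note def = impedance_passive_imp_cayley_defined[OF assms]
  show "2 * (x \<bullet> (matA (cayley S R) *v x + matB (cayley S R) *v v))
      \<le> (norm v)\<^sup>2 - (norm (matC (cayley S R) *v x + matD (cayley S R) *v v))\<^sup>2"
    using assms(1)[unfolded impedance_passive_iff, rule_format, of x ?w]
    unfolding cayley_state[OF def assms(2,3) refl] cayley_power[OF def assms(2,3) refl] by simp
qed

text \<open>
  Here \<open>1 - D = 2 Q inverse (D\<^sub>i + R) Q\<close> is a product of invertible matrices. That \<open>1\<close> is not an
  eigenvalue of \<open>D\<close> is exactly what makes a scattering passive system a Cayley transform.
\<close>

lemma cayley_feedthrough_fixed_point:
  assumes "cayley_defined S R" "positive_mat R" "invertible R" "matD (cayley S R) *v v = v"
  shows "v = 0"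
proof -
  let ?Q = "mat_sqrt R" and ?E = "matrix_inv (matD S + R)"
  have invQ: "invertible ?Q"
    using mat_sqrt_properties assms by blast
  have "2 *\<^sub>R (?Q *v (?E *v (?Q *v v))) = 0"
    using assms(4) by (simp add: cayley_sel matrix_action)
  then have "?E *v (?Q *v v) = 0"
    using invQ by (simp add: invertible_iff_ker)
  then have "(matD S + R) *v (?E *v (?Q *v v)) = 0"
    by simp
  then have "?Q *v v = 0"
    using assms(1) by (simp add: matrix_inv_mult_vector cayley_defined_def)
  then show ?thesis
    using invQ by (simp add: invertible_iff_ker)
qed

text \<open>
  At zero state the power lost by the wave \<open>v\<close> is \<open>w \<bullet> (D\<^sub>i\<^sup>T + D\<^sub>i) w\<close> with
  \<open>w = \<surd>2 inverse (D\<^sub>i + R) Q v\<close>. Proper passivity makes this form definite, and \<open>w \<noteq> 0\<close>.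
\<close>

lemma cayley_feedthrough_strict_contraction:
  assumes "properly_impedance_passive S" "positive_mat R" "invertible R" "v \<noteq> 0"
  shows "norm (matD (cayley S R) *v v) < norm v"
proof -
  let ?D = "matD S" and ?Q = "mat_sqrt R" and ?E = "matrix_inv (matD S + R)"
  have ip: "impedance_passive S" and inv: "invertible (transpose ?D + ?D)"
    using assms(1) by (auto simp: properly_impedance_passive_def)
  have def: "cayley_defined S R"
    by (rule impedance_passive_imp_cayley_defined[OF ip assms(2,3)])
  define w where "w = ?E *v (sqrt 2 *\<^sub>R (?Q *v v))"
  have w: "(norm v)\<^sup>2 - (norm (matD (cayley S R) *v v))\<^sup>2 = 2 * (w \<bullet> (?D *v w))"
    using cayley_power[OF def assms(2,3), of w v 0] by (simp add: w_def)
  have form: "z \<bullet> ((transpose ?D + ?D) *v z) = 2 * (z \<bullet> (?D *v z))" for z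
    by (simp add: matrix_action inner_add_right dot_lmul_matrix inner_commute[of z "z v* ?D"])
  have "positive_mat (transpose ?D + ?D)"
    unfolding positive_mat_def
  proof (intro conjI allI)
    show "transpose (transpose ?D + ?D) = transpose ?D + ?D"
      by (simp add: transpose_def vec_eq_iff add.commute)
    show "0 \<le> z \<bullet> ((transpose ?D + ?D) *v z)" for z
      unfolding form using ip[unfolded impedance_passive_iff, rule_format, of 0 z] by simp
  qed
  moreover have "w \<noteq> 0"
  proof
    assume "w = 0"
    then have "(?D + R) *v (?E *v (sqrt 2 *\<^sub>R (?Q *v v))) = 0"
      by (simp add: w_def)
    then have "?Q *v v = 0"
      using def by (simp add: matrix_inv_mult_vector cayley_defined_def)
    then show False
      using mat_sqrt_properties(3)[OF assms(2,3)] assms(4) by (simp add: invertible_iff_ker)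
  qed
  ultimately have "0 < w \<bullet> ((transpose ?D + ?D) *v w)"
    using inv by (intro positive_invertible_imp_definite)
  then have "(norm (matD (cayley S R) *v v))\<^sup>2 < (norm v)\<^sup>2"
    using w form[of w] by simp
  then show ?thesis
    by (rule power_less_imp_less_base) simp
qed

text \<open>
  Solving the transform for the original system gives \<open>D\<^sub>i = 2 Q F Q - R\<close> with
  \<open>F = inverse (1 - D)\<close>, and then \<open>B\<^sub>i\<close>, \<open>C\<^sub>i\<close> and \<open>A\<^sub>i\<close>. For passivity, the input \<open>w\<close> at state \<open>x\<close>
  corresponds to the wave \<open>v\<close> determined by \<open>(1 - D) v = C x + \<surd>2 Q w\<close>.
\<close>

lemma scattering_passive_imp_cayley_of_impedance_passive:
  fixes T :: "('n::finite, 'm::finite) linsys"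
  assumes T: "scattering_passive T" and inv: "invertible (mat 1 - matD T)"
    and R: "positive_mat R" "invertible R"
  obtains S :: "('n, 'm) linsys" where
    "impedance_passive S" "cayley_defined S R" "cayley S R = T"
proof -
  let ?Q = "mat_sqrt R"
  define F where "F = matrix_inv (mat 1 - matD T)"
  define S where "S = LinSys (matA T + matB T ** F ** matC T) (sqrt 2 *\<^sub>R (matB T ** F ** ?Q))
    (sqrt 2 *\<^sub>R (?Q ** F ** matC T)) (2 *\<^sub>R (?Q ** F ** ?Q) - R)"
  have S_sel: "matA S = matA T + matB T ** F ** matC T" "matB S = sqrt 2 *\<^sub>R (matB T ** F ** ?Q)"
    "matC S = sqrt 2 *\<^sub>R (?Q ** F ** matC T)" "matD S = 2 *\<^sub>R (?Q ** F ** ?Q) - R"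
    by (simp_all add: S_def)
  have Q: "transpose ?Q = ?Q" "invertible ?Q" "?Q *v (?Q *v z) = R *v z" for z
    using mat_sqrt_properties[OF R] by (auto simp: positive_mat_def matrix_vector_mul_assoc)
  have F1: "F *v z - matD T *v (F *v z) = z" for z
    using matrix_inv_mult_vector(2)[OF inv, of z] by (simp add: F_def matrix_action)
  have F2: "F *v (z - matD T *v z) = z" for z
    using matrix_inv_mult_vector(1)[OF inv, of z] by (simp add: F_def matrix_action)
  have F0: "F *v z = 0 \<Longrightarrow> z = 0" for z
    using F1[of z] by simp
  have imp: "impedance_passive S"
    unfolding impedance_passive_iff
  proof (intro allI)
    fix x w
    define v where "v = F *v (matC T *v x + sqrt 2 *\<^sub>R (?Q *v w))"
    have "matA T *v x + matB T *v v = matA S *v x + matB S *v w"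
      by (simp add: S_sel v_def matrix_action algebra_simps)
    moreover have "matC T *v x + matD T *v v = v - sqrt 2 *\<^sub>R (?Q *v w)"
      using F1[of "matC T *v x + sqrt 2 *\<^sub>R (?Q *v w)"] unfolding v_def[symmetric]
      by (simp add: algebra_simps)
    moreover have "matC S *v x + matD S *v w = sqrt 2 *\<^sub>R (?Q *v v) - ?Q *v (?Q *v w)"
      by (simp add: S_sel v_def matrix_action algebra_simps Q(3))
    ultimately show "x \<bullet> (matA S *v x + matB S *v w) \<le> w \<bullet> (matC S *v x + matD S *v w)"
      using T[unfolded scattering_passive_iff, rule_format, of x v] wave_power_balance[OF Q(1), of v w]
      by simp
  qed
  have defined: "cayley_defined S R"
    unfolding cayley_defined_def invertible_iff_ker
  proof (intro allI impI)
    fix z assume "(matD S + R) *v z = 0"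
    then have "?Q *v (F *v (?Q *v z)) = 0"
      by (simp add: S_sel matrix_action)
    then show "z = 0"
      using Q(2) F0 unfolding invertible_iff_ker by blast
  qed
  let ?E = "matrix_inv (matD S + R)"
  have E: "?Q *v (?E *v (?Q *v z)) = (1/2) *\<^sub>R (z - matD T *v z)" for z
  proof -
    obtain y where y: "?Q *v y = (1/2) *\<^sub>R (z - matD T *v z)"
      using matrix_inv_mult_vector(2)[OF Q(2)] by metis
    have "(matD S + R) *v y = 2 *\<^sub>R (?Q *v (F *v (?Q *v y)))"
      by (simp add: S_sel matrix_action)
    also have "\<dots> = ?Q *v z"
      by (simp add: y matrix_vector_mult_scaleR F2)
    finally have "(matD S + R) *v y = ?Q *v z" .
    then have "?E *v (?Q *v z) = y"
      using defined matrix_inv_mult_vector(1) unfolding cayley_defined_def by metis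
    then show ?thesis
      by (simp add: y)
  qed
  have EF: "?Q *v (?E *v (?Q *v (F *v z))) = (1/2) *\<^sub>R z" for z
    by (simp add: E F1)
  have FE: "F *v (?Q *v (?E *v (?Q *v z))) = (1/2) *\<^sub>R z" for z
    by (simp add: E F2 matrix_vector_mult_scaleR)
  have "matA (cayley S R) = matA T"
    by (simp add: matrix_eq cayley_sel S_sel(1-3) matrix_action FE)
  moreover have "matB (cayley S R) = matB T"
    by (simp add: matrix_eq cayley_sel S_sel(1-3) matrix_action FE)
  moreover have "matC (cayley S R) = matC T"
    by (simp add: matrix_eq cayley_sel S_sel(1-3) matrix_action EF)
  moreover have "matD (cayley S R) = matD T"
    by (simp add: matrix_eq cayley_sel S_sel(1-3) matrix_action E)
  ultimately have "cayley S R = T"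
    by (intro linsys.expand) simp
  with imp defined show thesis
    by (rule that)
qed

section \<open>Block vectors and block diagonal matrices\<close>

definition stack :: "real^'a \<Rightarrow> real^'b \<Rightarrow> real^('a::finite + 'b::finite)" where
  "stack x y = (\<chi> i. case i of Inl a \<Rightarrow> x $ a | Inr b \<Rightarrow> y $ b)"

lemma stack_cases:
  fixes z :: "real^('a::finite + 'b::finite)"
  obtains x :: "real^'a" and y :: "real^'b" where "z = stack x y"
proof
  show "z = stack (\<chi> i. z $ Inl i) (\<chi> i. z $ Inr i)"
    by (simp add: stack_def vec_eq_iff split: sum.split)
qed

lemma sum_UNIV_sum_type:
  fixes f :: "'a::finite + 'b::finite \<Rightarrow> real"
  shows "(\<Sum>i\<in>UNIV. f i) = (\<Sum>a\<in>UNIV. f (Inl a)) + (\<Sum>b\<in>UNIV. f (Inr b))"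
  unfolding UNIV_Plus_UNIV[symmetric] by (subst sum.Plus) (auto simp: comp_def)

lemma stack_eq_iff [simp]: "stack x y = stack x' y' \<longleftrightarrow> x = x' \<and> y = y'"
  by (auto simp: stack_def vec_eq_iff split: sum.split)

lemma stack_eq_0_iff [simp]: "stack x y = 0 \<longleftrightarrow> x = 0 \<and> y = 0"
  by (auto simp: stack_def vec_eq_iff split: sum.split)

lemma stack_0 [simp]: "stack 0 0 = 0"
  by simp

lemma stack_add: "stack x y + stack x' y' = stack (x + x') (y + y')"
  by (simp add: stack_def vec_eq_iff split: sum.split)

lemma inner_stack [simp]: "stack x y \<bullet> stack x' y' = x \<bullet> x' + y \<bullet> y'"
  by (simp add: stack_def inner_vec_def sum_UNIV_sum_type)

lemma norm_stack: "(norm (stack x y))\<^sup>2 = (norm x)\<^sup>2 + (norm y)\<^sup>2"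
  by (simp add: power2_norm_eq_inner)

lemma block_mat_mult_stack:
  "block_mat M11 M12 M21 M22 *v stack x y = stack (M11 *v x + M12 *v y) (M21 *v x + M22 *v y)"
  by (simp add: stack_def block_mat_def vec_eq_iff matrix_vector_mult_def sum_UNIV_sum_type
      split: sum.split)

lemma mult_stack: "M *v stack x y = col1 M *v x + col2 M *v y"
  by (simp add: stack_def col1_def col2_def vec_eq_iff matrix_vector_mult_def sum_UNIV_sum_type)

lemma mult_eq_stack: "M *v x = stack (row1 M *v x) (row2 M *v x)"
  by (simp add: stack_def row1_def row2_def vec_eq_iff matrix_vector_mult_def split: sum.split)

lemma mult_stack_eq_stack:
  "M *v stack x y = stack (row1 (col1 M) *v x + row1 (col2 M) *v y)
                          (row2 (col1 M) *v x + row2 (col2 M) *v y)"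
  by (simp add: mult_stack mult_eq_stack[of "col1 M"] mult_eq_stack[of "col2 M"] stack_add)

lemma positive_block_diag_iff:
  fixes M :: "real^'a^'a::finite" and N :: "real^'b^'b::finite"
  shows "positive_mat (block_diag M N) \<longleftrightarrow> positive_mat M \<and> positive_mat N"
proof -
  have "transpose (block_diag M N) = block_diag M N \<longleftrightarrow> transpose M = M \<and> transpose N = N"
    by (auto simp: transpose_def block_mat_def vec_eq_iff split: sum.split)
  moreover have "(\<forall>z. 0 \<le> z \<bullet> (block_diag M N *v z))
      \<longleftrightarrow> (\<forall>x. 0 \<le> x \<bullet> (M *v x)) \<and> (\<forall>y. 0 \<le> y \<bullet> (N *v y))" (is "?L \<longleftrightarrow> ?R")
  proof
    assume L: ?L
    show ?R
      using L[rule_format, of "stack _ 0"] L[rule_format, of "stack 0 _"]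
      by (simp add: block_mat_mult_stack)
  next
    assume R: ?R
    show ?L
    proof
      fix z :: "real^('a + 'b)"
      obtain x :: "real^'a" and y :: "real^'b" where "z = stack x y"
        by (rule stack_cases)
      with R show "0 \<le> z \<bullet> (block_diag M N *v z)"
        by (simp add: block_mat_mult_stack)
    qed
  qed
  ultimately show ?thesis
    by (auto simp: positive_mat_def)
qed

lemma invertible_block_diag_iff:
  fixes M :: "real^'a^'a::finite" and N :: "real^'b^'b::finite"
  shows "invertible (block_diag M N) \<longleftrightarrow> invertible M \<and> invertible N"
proof -
  have "(\<forall>z. block_diag M N *v z = 0 \<longrightarrow> z = 0)
      \<longleftrightarrow> (\<forall>x. M *v x = 0 \<longrightarrow> x = 0) \<and> (\<forall>y. N *v y = 0 \<longrightarrow> y = 0)" (is "?L \<longleftrightarrow> ?R")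
  proof
    assume L: ?L
    show ?R
      using L[rule_format, of "stack _ 0"] L[rule_format, of "stack 0 _"]
      by (simp add: block_mat_mult_stack)
  next
    assume R: ?R
    show ?L
    proof (intro allI impI)
      fix z :: "real^('a + 'b)" assume z: "block_diag M N *v z = 0"
      obtain x :: "real^'a" and y :: "real^'b" where "z = stack x y"
        by (rule stack_cases)
      with R z show "z = 0"
        by (simp add: block_mat_mult_stack)
    qed
  qed
  then show ?thesis
    by (simp add: invertible_iff_ker)
qed

section \<open>The star product as a feedback connection\<close>

text \<open>
  The loop equations \<open>w = a + D\<^sub>p\<^sub>2\<^sub>2 v\<close>, \<open>v = b + D\<^sub>q\<^sub>1\<^sub>1 w\<close> describe the two internal signals
  driven by \<open>a\<close> and \<open>b\<close>. The definition of the star product eliminates \<open>v\<close> with \<open>Delta2\<close> and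
  \<open>w\<close> with \<open>Delta1\<close> independently; the lemma says that these two eliminations are compatible.
\<close>

lemma well_posed_loop_signals:
  assumes "well_posed P Q"
    and v: "v = matrix_inv (Delta2 P Q) *v (b + row1 (col1 (matD Q)) *v a)"
    and w: "w = matrix_inv (Delta1 P Q) *v (a + row2 (col2 (matD P)) *v b)"
  shows "w = a + row2 (col2 (matD P)) *v v" "v = b + row1 (col1 (matD Q)) *v w"
proof -
  let ?M = "row2 (col2 (matD P))" and ?N = "row1 (col1 (matD Q))"
  have inv: "invertible (Delta1 P Q)" "invertible (Delta2 P Q)"
    using assms(1) by (auto simp: well_posed_def)
  have "Delta2 P Q *v v = b + ?N *v a"
    by (simp add: v matrix_inv_mult_vector inv)
  then have 2: "v = b + ?N *v (a + ?M *v v)"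
    by (simp add: Delta2_def matrix_action algebra_simps)
  have "Delta1 P Q *v (a + ?M *v v) = (a + ?M *v v) - ?M *v (?N *v (a + ?M *v v))"
    by (simp only: Delta1_def matrix_vector_mult_diff_rdistrib matrix_vector_mul_lid
        matrix_vector_mul_assoc)
  also have "?N *v (a + ?M *v v) = v - b"
    using 2 by (metis add_diff_cancel_left')
  finally have "Delta1 P Q *v (a + ?M *v v) = a + ?M *v b"
    by (simp add: matrix_vector_mult_diff_distrib)
  then show 1: "w = a + ?M *v v"
    unfolding w using matrix_inv_mult_vector(1)[OF inv(1)] by metis
  show "v = b + ?N *v w"
    using 1 2 by simp
qed

text \<open>
  The matrices of the star product are used only through this description: they implement the
  interconnection \<open>u\<^sub>2 = y'\<^sub>1 = v\<close>, \<open>u'\<^sub>1 = y\<^sub>2 = w\<close>.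
\<close>

lemma star_signals:
  fixes P :: "('n::finite, 'k::finite + 'k) linsys" and Q :: "('q::finite, 'k + 'k) linsys"
  assumes "well_posed P Q"
  obtains v w y1 y2 where
    "matC P *v xp + matD P *v stack u1 v = stack y1 w"
    "matC Q *v xq + matD Q *v stack w u2 = stack v y2"
    "matA (star P Q) *v stack xp xq + matB (star P Q) *v stack u1 u2 =
      stack (matA P *v xp + matB P *v stack u1 v) (matA Q *v xq + matB Q *v stack w u2)"
    "matC (star P Q) *v stack xp xq + matD (star P Q) *v stack u1 u2 = stack y1 y2"
proof -
  let ?Dp = "matD P" and ?Dq = "matD Q"
  define a where "a = row2 (matC P) *v xp + row2 (col1 ?Dp) *v u1"
  define b where "b = row1 (matC Q) *v xq + row1 (col2 ?Dq) *v u2"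
  define v where "v = matrix_inv (Delta2 P Q) *v (b + row1 (col1 ?Dq) *v a)"
  define w where "w = matrix_inv (Delta1 P Q) *v (a + row2 (col2 ?Dp) *v b)"
  have loop: "w = a + row2 (col2 ?Dp) *v v" "v = b + row1 (col1 ?Dq) *v w"
    using well_posed_loop_signals[OF assms v_def w_def] .
  define y1 where "y1 = row1 (matC P) *v xp + row1 (col1 ?Dp) *v u1 + row1 (col2 ?Dp) *v v"
  define y2 where "y2 = row2 (matC Q) *v xq + row2 (col1 ?Dq) *v w + row2 (col2 ?Dq) *v u2"
  have "matC P *v xp + ?Dp *v stack u1 v = stack y1 w"
    using loop(1)
    by (simp add: mult_eq_stack[of "matC P"] mult_stack_eq_stack stack_add y1_def a_def add.assoc)
  moreover have "matC Q *v xq + ?Dq *v stack w u2 = stack v y2"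
    using loop(2)
    by (simp add: mult_eq_stack[of "matC Q"] mult_stack_eq_stack stack_add y2_def b_def ac_simps)
  moreover have "matA (star P Q) *v stack xp xq + matB (star P Q) *v stack u1 u2 =
      stack (matA P *v xp + matB P *v stack u1 v) (matA Q *v xq + matB Q *v stack w u2)"
    by (simp add: star_def Let_def block_mat_mult_stack stack_add mult_stack[of "matB P"]
        mult_stack[of "matB Q"] v_def w_def a_def b_def matrix_action algebra_simps)
  moreover have "matC (star P Q) *v stack xp xq + matD (star P Q) *v stack u1 u2 = stack y1 y2"
    by (simp add: star_def Let_def block_mat_mult_stack stack_add y1_def y2_def v_def w_def a_def
        b_def matrix_action algebra_simps)
  ultimately show thesis
    by (rule that)
qed

text \<open>
  In the sum of the two dissipation inequalities the power carried by the internal signals cancels.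
\<close>

lemma scattering_passive_star:
  fixes P :: "('n::finite, 'k::finite + 'k) linsys" and Q :: "('q::finite, 'k + 'k) linsys"
  assumes "well_posed P Q" "scattering_passive P" "scattering_passive Q"
  shows "scattering_passive (star P Q)"
  unfolding scattering_passive_iff
proof (intro allI)
  fix x :: "real^('n + 'q)" and u :: "real^('k + 'k)"
  obtain xp :: "real^'n" and xq :: "real^'q" where x: "x = stack xp xq"
    by (rule stack_cases)
  obtain u1 u2 :: "real^'k" where u: "u = stack u1 u2"
    by (rule stack_cases)
  obtain v w y1 y2 where sig:
    "matC P *v xp + matD P *v stack u1 v = stack y1 w"
    "matC Q *v xq + matD Q *v stack w u2 = stack v y2"
    "matA (star P Q) *v stack xp xq + matB (star P Q) *v stack u1 u2 =
      stack (matA P *v xp + matB P *v stack u1 v) (matA Q *v xq + matB Q *v stack w u2)"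
    "matC (star P Q) *v stack xp xq + matD (star P Q) *v stack u1 u2 = stack y1 y2"
    by (rule star_signals[OF assms(1)])
  show "2 * (x \<bullet> (matA (star P Q) *v x + matB (star P Q) *v u))
      \<le> (norm u)\<^sup>2 - (norm (matC (star P Q) *v x + matD (star P Q) *v u))\<^sup>2"
    using assms(2)[unfolded scattering_passive_iff, rule_format, of xp "stack u1 v"]
      assms(3)[unfolded scattering_passive_iff, rule_format, of xq "stack w u2"]
    unfolding x u sig inner_stack norm_stack by simp
qed

section \<open>Contractive feedthrough matrices in the loop\<close>

lemma scattering_passive_feedthrough_contraction:
  assumes "scattering_passive S"
  shows "norm (matD S *v u) \<le> norm u"
proof -
  have "(norm (matD S *v u))\<^sup>2 \<le> (norm u)\<^sup>2"
    using assms[unfolded scattering_passive_iff, rule_format, of 0 u] by simp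
  then show ?thesis
    by (rule power2_le_imp_le) simp
qed

text \<open>
  A nonzero fixed point of \<open>M N\<close> would lose norm in the strictly contractive factor and cannot
  regain it in the other.
\<close>

lemma invertible_id_minus_mult:
  fixes M :: "real^'m^'n" and N :: "real^'n^'m"
  assumes "\<And>x. norm (M *v x) \<le> norm x" "\<And>x. norm (N *v x) \<le> norm x"
    and "(\<forall>x. x \<noteq> 0 \<longrightarrow> norm (M *v x) < norm x) \<or> (\<forall>x. x \<noteq> 0 \<longrightarrow> norm (N *v x) < norm x)"
  shows "invertible (mat 1 - M ** N)"
  unfolding invertible_iff_ker
proof (intro allI impI, rule ccontr)
  fix x assume "(mat 1 - M ** N) *v x = 0" and "x \<noteq> 0"
  then have x: "M *v (N *v x) = x"
    by (simp add: matrix_action)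
  then have "N *v x \<noteq> 0"
    using \<open>x \<noteq> 0\<close> by auto
  then have "norm (M *v (N *v x)) < norm x"
    using assms \<open>x \<noteq> 0\<close> by (meson le_less_trans less_le_trans)
  then show False
    by (simp add: x)
qed

lemma well_posed_of_contractions:
  fixes P :: "('n::finite, 'k::finite + 'k) linsys" and Q :: "('q::finite, 'k + 'k) linsys"
  assumes P: "\<And>u. norm (matD P *v u) \<le> norm u" and Q: "\<And>u. norm (matD Q *v u) \<le> norm u"
    and strict: "(\<forall>u. u \<noteq> 0 \<longrightarrow> norm (matD P *v u) < norm u) \<or>
      (\<forall>u. u \<noteq> 0 \<longrightarrow> norm (matD Q *v u) < norm u)"
  shows "well_posed P Q"
proof -
  let ?M = "row2 (col2 (matD P))" and ?N = "row1 (col1 (matD Q))"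
  have M: "(norm (?M *v x))\<^sup>2 \<le> (norm (matD P *v stack 0 x))\<^sup>2"
    and N: "(norm (?N *v x))\<^sup>2 \<le> (norm (matD Q *v stack x 0))\<^sup>2" for x
    by (simp_all add: mult_stack_eq_stack norm_stack)
  have *: "norm (stack 0 x :: real^('k+'k)) = norm x" "norm (stack x 0 :: real^('k+'k)) = norm x"
    for x :: "real^'k"
    unfolding norm_eq_sqrt_inner inner_stack by simp_all
  have M: "norm (?M *v x) \<le> norm (matD P *v stack 0 x)"
    and N: "norm (?N *v x) \<le> norm (matD Q *v stack x 0)" for x
    using power2_le_imp_le[OF M[of x]] power2_le_imp_le[OF N[of x]] by simp_all
  have le: "norm (?M *v x) \<le> norm x" "norm (?N *v x) \<le> norm x" for x
    using M[of x] N[of x] P[of "stack 0 x"] Q[of "stack x 0"] by (simp_all add: *)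
  have less: "(\<forall>x. x \<noteq> 0 \<longrightarrow> norm (?M *v x) < norm x) \<or> (\<forall>x. x \<noteq> 0 \<longrightarrow> norm (?N *v x) < norm x)"
    using strict
  proof
    assume s: "\<forall>u. u \<noteq> 0 \<longrightarrow> norm (matD P *v u) < norm u"
    have "norm (?M *v x) < norm x" if "x \<noteq> 0" for x
      using M[of x] s[rule_format, of "stack 0 x"] that by (simp add: *)
    then show ?thesis by blast
  next
    assume s: "\<forall>u. u \<noteq> 0 \<longrightarrow> norm (matD Q *v u) < norm u"
    have "norm (?N *v x) < norm x" if "x \<noteq> 0" for x
      using N[of x] s[rule_format, of "stack x 0"] that by (simp add: *)
    then show ?thesis by blast
  qed
  show ?thesis
    unfolding well_posed_def Delta1_def Delta2_def
    using le less by (auto intro!: invertible_id_minus_mult)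
qed

text \<open>
  If the external output \<open>(u\<^sub>1, u\<^sub>2)\<close> equals the external input, contractivity of both factors gives
  \<open>|w| \<le> |v|\<close> and \<open>|v| \<le> |w|\<close>, so neither factor loses norm on its signals. The strictly
  contractive one then has zero input, hence \<open>v = w = 0\<close>, and the external signals are fixed points
  of the two factors.
\<close>

lemma star_feedthrough_fixed_point:
  fixes P :: "('n::finite, 'k::finite + 'k) linsys" and Q :: "('q::finite, 'k + 'k) linsys"
  assumes P: "\<And>u. norm (matD P *v u) \<le> norm u" and Q: "\<And>u. norm (matD Q *v u) \<le> norm u"
    and strict: "(\<forall>u. u \<noteq> 0 \<longrightarrow> norm (matD P *v u) < norm u) \<or>
      (\<forall>u. u \<noteq> 0 \<longrightarrow> norm (matD Q *v u) < norm u)"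
    and fixP: "\<And>u. matD P *v u = u \<Longrightarrow> u = 0" and fixQ: "\<And>u. matD Q *v u = u \<Longrightarrow> u = 0"
    and u: "matD (star P Q) *v u = u"
  shows "u = 0"
proof -
  obtain u1 u2 :: "real^'k" where u12: "u = stack u1 u2"
    by (rule stack_cases)
  have "well_posed P Q"
    using P Q strict by (rule well_posed_of_contractions)
  then obtain v w y1 y2 where sig:
    "matC P *v 0 + matD P *v stack u1 v = stack y1 w"
    "matC Q *v 0 + matD Q *v stack w u2 = stack v y2"
    "matC (star P Q) *v stack 0 0 + matD (star P Q) *v stack u1 u2 = stack y1 y2"
    by (rule star_signals)
  have "stack y1 y2 = stack u1 u2"
    using sig(3) u unfolding u12 by simp
  then have y: "y1 = u1" "y2 = u2"
    by simp_all
  have sP: "matD P *v stack u1 v = stack u1 w" and sQ: "matD Q *v stack w u2 = stack v u2"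
    using sig(1,2) y by simp_all
  have nP: "norm (stack u1 w) \<le> norm (stack u1 v)" and nQ: "norm (stack v u2) \<le> norm (stack w u2)"
    using P[of "stack u1 v"] Q[of "stack w u2"] by (simp_all add: sP sQ)
  then have wv: "(norm w)\<^sup>2 = (norm v)\<^sup>2"
    using power_mono[OF nP, of 2] power_mono[OF nQ, of 2] by (simp add: norm_stack)
  have eq: "norm (stack u1 w) = norm (stack u1 v)" "norm (stack v u2) = norm (stack w u2)"
    by (rule power2_eq_imp_eq; simp add: norm_stack wv)+
  have "v = 0 \<and> w = 0"
    using strict
  proof
    assume s: "\<forall>u. u \<noteq> 0 \<longrightarrow> norm (matD P *v u) < norm u"
    then have "stack u1 v = 0"
      using eq(1) sP by (metis less_irrefl)
    then show ?thesis
      using wv by simp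
  next
    assume s: "\<forall>u. u \<noteq> 0 \<longrightarrow> norm (matD Q *v u) < norm u"
    then have "stack w u2 = 0"
      using eq(2) sQ by (metis less_irrefl)
    then show ?thesis
      using wv by simp
  qed
  then have "stack u1 0 = (0 :: real^('k + 'k))" "stack 0 u2 = (0 :: real^('k + 'k))"
    using sP sQ fixP[of "stack u1 0"] fixQ[of "stack 0 u2"] by auto
  then show ?thesis
    by (simp add: u12)
qed

section \<open>The star product of two Cayley transforms\<close>

theorem theorem18:
  fixes Spi :: "('n::finite, 'k::finite + 'k) linsys"
    and Sqi :: "('q::finite, 'k + 'k) linsys"
    and Rp1 Rp2 Rq1 Rq2 :: "real^'k^'k"
    and Rp Rq Rpq :: "real^('k + 'k)^('k + 'k)"
    and Sp :: "('n, 'k + 'k) linsys"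
    and Sq :: "('q, 'k + 'k) linsys"
  assumes "impedance_passive Spi" and "impedance_passive Sqi"
    and "properly_impedance_passive Spi \<or> properly_impedance_passive Sqi"
    and "Rp = block_diag Rp1 Rp2" and "Rq = block_diag Rq1 Rq2"
    and "positive_mat Rp" and "invertible Rp"
    and "positive_mat Rq" and "invertible Rq"
    and "Rp2 = Rq1"
    and "Sp = cayley Spi Rp" and "Sq = cayley Sqi Rq"
    and "Rpq = block_diag Rp1 Rq2"
  shows "cayley_defined Spi Rp \<and> scattering_passive Sp \<and>
         cayley_defined Sqi Rq \<and> scattering_passive Sq \<and>
         well_posed Sp Sq \<and>
         (\<exists>Si' :: ('n + 'q, 'k + 'k) linsys.
            impedance_passive Si' \<and> cayley_defined Si' Rpq \<and> cayley Si' Rpq = star Sp Sq)"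
proof -
  note Rp = \<open>positive_mat Rp\<close> \<open>invertible Rp\<close> and Rq = \<open>positive_mat Rq\<close> \<open>invertible Rq\<close>
  have def: "cayley_defined Spi Rp" "cayley_defined Sqi Rq"
    using impedance_passive_imp_cayley_defined assms by blast+
  have scat: "scattering_passive Sp" "scattering_passive Sq"
    using scattering_passive_cayley assms by blast+
  have contr: "norm (matD Sp *v u) \<le> norm u" "norm (matD Sq *v u) \<le> norm u" for u
    using scat by (auto intro: scattering_passive_feedthrough_contraction)
  have strict: "(\<forall>u. u \<noteq> 0 \<longrightarrow> norm (matD Sp *v u) < norm u) \<or>
      (\<forall>u. u \<noteq> 0 \<longrightarrow> norm (matD Sq *v u) < norm u)"
    using assms(3) cayley_feedthrough_strict_contraction[OF _ Rp, of Spi]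
      cayley_feedthrough_strict_contraction[OF _ Rq, of Sqi]
    unfolding \<open>Sp = cayley Spi Rp\<close> \<open>Sq = cayley Sqi Rq\<close> by blast
  have fixed: "matD Sp *v u = u \<Longrightarrow> u = 0" "matD Sq *v u = u \<Longrightarrow> u = 0" for u
    using cayley_feedthrough_fixed_point[OF def(1) Rp] cayley_feedthrough_fixed_point[OF def(2) Rq]
    unfolding \<open>Sp = cayley Spi Rp\<close> \<open>Sq = cayley Sqi Rq\<close> by blast+
  have wp: "well_posed Sp Sq"
    using contr strict by (rule well_posed_of_contractions)
  have Rpq: "positive_mat Rpq" "invertible Rpq"
    using Rp Rq unfolding \<open>Rp = block_diag Rp1 Rp2\<close> \<open>Rq = block_diag Rq1 Rq2\<close>
      \<open>Rpq = block_diag Rp1 Rq2\<close> positive_block_diag_iff invertible_block_diag_iff by auto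
  have "invertible (mat 1 - matD (star Sp Sq))"
    unfolding invertible_iff_ker
  proof (intro allI impI)
    fix u assume "(mat 1 - matD (star Sp Sq)) *v u = 0"
    then have "matD (star Sp Sq) *v u = u"
      by (simp add: matrix_action)
    then show "u = 0"
      using star_feedthrough_fixed_point[of Sp Sq u] contr strict fixed by blast
  qed
  then obtain Si' :: "('n + 'q, 'k + 'k) linsys" where
    "impedance_passive Si'" "cayley_defined Si' Rpq" "cayley Si' Rpq = star Sp Sq"
    using scattering_passive_imp_cayley_of_impedance_passive[
        OF scattering_passive_star[OF wp scat] _ Rpq] by blast
  with def scat wp show ?thesis
    by blast
qed

end
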